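(* For all $t\in\mathbb{N}$ such that $t\ge 3$, $gr^t_2(B_3)=6$.
   Context: $K_n$ is the complete graph of order $n$. The book $B_n:=K_2+nK_1$ (graph join) is the graph on $n+2$ vertices consisting of an edge $xy$ (the spine) together with $n$ further, pairwise non-adjacent vertices (the pages), each adjacent to both $x$ and $y$. A $t$-coloring of $K_p$ is a map $f:E(K_p)\to\{1,\dots,t\}$, not assumed surjective. A Gallai $t$-coloring is a $t$-coloring with no rainbow triangle, i.e. there are no three vertices $x,y,z$ such that $f(xy),f(xz),f(yz)$ are pairwise distinct. For $1\le s<t$ and a graph $G$, the weakened Gallai-Ramsey number $gr^t_s(G)$ is the least $p\in\mathbb{N}$ such that every Gallai $t$-coloring of $K_p$ contains a (not necessarily induced) subgraph isomorphic to $G$ whose edges use at most $s$ colors. *)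

theory Defs
  imports "HOL-Library.Extended_Nat"
begin

record 'a sgraph =
  verts :: "'a set"
  edges :: "'a set set"

definition complete_graph :: "'a set \<Rightarrow> 'a sgraph" where
  "complete_graph V = \<lparr>verts = V, edges = {e. e \<subseteq> V \<and> card e = 2}\<rparr>"

definition edgeless_graph :: "'a set \<Rightarrow> 'a sgraph" where
  "edgeless_graph V = \<lparr>verts = V, edges = {}\<rparr>"

definition graph_join :: "'a sgraph \<Rightarrow> 'b sgraph \<Rightarrow> ('a + 'b) sgraph" where
  "graph_join G H =
     \<lparr>verts = Inl ` verts G \<union> Inr ` verts H,
      edges = image Inl ` edges G \<union> image Inr ` edges H
                \<union> {{Inl u, Inr v} |u v. u \<in> verts G \<and> v \<in> verts H}\<rparr>"

abbreviation K :: "nat \<Rightarrow> nat sgraph" where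
  "K p \<equiv> complete_graph {..<p}"

definition book :: "nat \<Rightarrow> (nat + nat) sgraph" where
  "book n = graph_join (K 2) (edgeless_graph {..<n})"

definition is_subgraph :: "'a sgraph \<Rightarrow> 'a sgraph \<Rightarrow> bool" where
  "is_subgraph H G \<longleftrightarrow>
     verts H \<subseteq> verts G \<and> edges H \<subseteq> edges G \<and> (\<forall>e\<in>edges H. e \<subseteq> verts H)"

definition isomorphic :: "'a sgraph \<Rightarrow> 'b sgraph \<Rightarrow> bool" where
  "isomorphic G H \<longleftrightarrow>
     (\<exists>\<phi>. bij_betw \<phi> (verts G) (verts H) \<and> edges H = image \<phi> ` edges G)"

text \<open>A coloring is a total function on vertex sets; only its values on the edges of
  the complete graph matter.\<close>

definition coloring :: "nat \<Rightarrow> nat \<Rightarrow> (nat set \<Rightarrow> nat) \<Rightarrow> bool" where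
  "coloring t p f \<longleftrightarrow> (\<forall>e\<in>edges (K p). f e \<in> {1..t})"

definition rainbow_triangle :: "nat \<Rightarrow> (nat set \<Rightarrow> nat) \<Rightarrow> nat \<Rightarrow> nat \<Rightarrow> nat \<Rightarrow> bool" where
  "rainbow_triangle p f x y z \<longleftrightarrow>
     x \<in> verts (K p) \<and> y \<in> verts (K p) \<and> z \<in> verts (K p) \<and>
     x \<noteq> y \<and> x \<noteq> z \<and> y \<noteq> z \<and>
     f {x, y} \<noteq> f {x, z} \<and> f {x, y} \<noteq> f {y, z} \<and> f {x, z} \<noteq> f {y, z}"

definition gallai_coloring :: "nat \<Rightarrow> nat \<Rightarrow> (nat set \<Rightarrow> nat) \<Rightarrow> bool" where
  "gallai_coloring t p f \<longleftrightarrow> coloring t p f \<and> (\<nexists>x y z. rainbow_triangle p f x y z)"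

text \<open>The value lies in \<open>enat\<close>, where the infimum of a nonempty set is its least element
  and that of the empty set is \<open>\<infinity>\<close>: a finite value entails that a suitable \<open>p\<close> exists.
  The definition is meant for \<open>1 \<le> s < t\<close>.\<close>

definition gallai_ramsey :: "nat \<Rightarrow> nat \<Rightarrow> 'a sgraph \<Rightarrow> enat" where
  "gallai_ramsey t s G =
     Inf {enat p |p. \<forall>f. gallai_coloring t p f \<longrightarrow>
               (\<exists>H. is_subgraph H (K p) \<and> isomorphic G H \<and> card (f ` edges H) \<le> s)}"

end

theory Submission
  imports Defs
begin

text \<open>For the upper bound, suppose a Gallai coloring of \<open>K\<^sub>6\<close> has no book \<open>B\<^sub>3\<close> in at most two
  colors. If three edges at \<open>v\<close> have color \<open>c\<close> and a fourth edge \<open>vw\<close> does not, then the book with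
  spine \<open>vw\<close> on these three edges is two-colored by the Gallai condition. So a vertex either has all
  its edges in one color or sees no color three times. Two vertices of the first kind span a
  monochromatic book, so after deleting one vertex there remains a Gallai coloring of \<open>K\<^sub>5\<close> in which
  no vertex sees a color three times. Such a coloring uses only two colors, and hence contains a
  two-colored book.

  For the lower bound, join the vertices of a 4-cycle of color 1, with diagonals of color 3, to a
  fifth vertex by edges of color 2. Every vertex of the 4-cycle sees all three colors, and every
  spine contains such a vertex.\<close>

lemma edges_book:
  "edges (book n) = insert {Inl 0, Inl 1} ((\<lambda>(i, j). {Inl i, Inr j}) ` ({..<2} \<times> {..<n}))"
proof -
  have "e \<subseteq> {..<2} \<and> card e = 2 \<longleftrightarrow> e = {..<2::nat}" for e
    using card_subset_eq[of "{..<2}" e] by auto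
  moreover have "{..<2::nat} = {0, 1}" by auto
  ultimately have "{e. e \<subseteq> {..<2::nat} \<and> card e = 2} = {{0, 1}}" by simp
  then show ?thesis
    unfolding book_def graph_join_def complete_graph_def edgeless_graph_def
    by (auto simp: image_iff)
qed

lemma verts_book: "verts (book n) = Inl ` {..<2} \<union> Inr ` {..<n}"
  by (simp add: book_def graph_join_def complete_graph_def edgeless_graph_def)

lemma edges_book_3:
  "edges (book 3) = {{Inl 0, Inl 1}, {Inl 0, Inr 0}, {Inl 0, Inr 1}, {Inl 0, Inr 2},
     {Inl 1, Inr 0}, {Inl 1, Inr 1}, {Inl 1, Inr 2}}"
proof -
  have "{..<2::nat} = {0, 1}" "{..<3::nat} = {0, 1, 2}" by auto
  then show ?thesis by (simp add: edges_book insert_Times_insert)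
qed

lemma verts_book_3: "verts (book 3) = {Inl 0, Inl 1, Inr 0, Inr 1, Inr 2}"
proof -
  have "{..<2::nat} = {0, 1}" "{..<3::nat} = {0, 1, 2}" by auto
  then show ?thesis by (auto simp: verts_book)
qed

lemma book_3_copy:
  assumes "distinct [x, y, p, q, r]" and "{x, y, p, q, r} \<subseteq> {..<n}"
    and "f ` {{x, y}, {x, p}, {x, q}, {x, r}, {y, p}, {y, q}, {y, r}} \<subseteq> {a, b}"
  shows "\<exists>H. is_subgraph H (K n) \<and> isomorphic (book 3) H \<and> card (f ` edges H) \<le> 2"
proof -
  define E where "E = {{x, y}, {x, p}, {x, q}, {x, r}, {y, p}, {y, q}, {y, r}}"
  define H where "H = \<lparr>verts = {x, y, p, q, r}, edges = E\<rparr>"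
  define \<phi> :: "nat + nat \<Rightarrow> nat"
    where "\<phi> = case_sum (\<lambda>i. if i = 0 then x else y) (\<lambda>j. if j = 0 then p else if j = 1 then q else r)"
  have "is_subgraph H (K n)"
    using assms(1,2) by (auto simp: is_subgraph_def H_def E_def complete_graph_def)
  moreover have "isomorphic (book 3) H"
    unfolding isomorphic_def
  proof (intro exI conjI)
    show "bij_betw \<phi> (verts (book 3)) (verts H)"
      using assms(1) unfolding bij_betw_def inj_on_def verts_book_3 by (auto simp: H_def \<phi>_def)
    show "edges H = image \<phi> ` edges (book 3)"
      unfolding edges_book_3 by (simp add: H_def E_def \<phi>_def)
  qed
  moreover have "card (f ` edges H) \<le> 2"
  proof -
    have "card (f ` E) \<le> card {a, b}"
      by (rule card_mono) (use assms(3) in \<open>simp_all add: E_def\<close>)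
    also have "\<dots> \<le> 2" by (simp add: card_insert_if)
    finally show ?thesis by (simp add: H_def)
  qed
  ultimately show ?thesis by blast
qed

text \<open>If a vertex saw three or more colors, at least five edges would join neighbors seen in
  different colors. Each such edge repeats the color from the vertex to one of its ends, but each of
  the four neighbors admits only one repetition. So every vertex sees exactly two colors, twice
  each, and no third color arises. The conclusion concerns the book with spine \<open>ab\<close>; if
  \<open>ac = ab\<close>, then \<open>ad\<close> supplies the second color.\<close>

lemma K5_two_colored:
  fixes ab ac ad ae bc bd be cd ce de :: 'c
  assumes "ab = ac \<or> ab = bc \<or> ac = bc" "ab = ad \<or> ab = bd \<or> ad = bd"
    "ab = ae \<or> ab = be \<or> ae = be" "ac = ad \<or> ac = cd \<or> ad = cd"
    "ac = ae \<or> ac = ce \<or> ae = ce" "ad = ae \<or> ad = de \<or> ae = de"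
    "bc = bd \<or> bc = cd \<or> bd = cd" "bc = be \<or> bc = ce \<or> be = ce"
    "bd = be \<or> bd = de \<or> be = de" "cd = ce \<or> cd = de \<or> ce = de"
    and "\<not> (ab = ac \<and> ac = ad)" "\<not> (ab = ac \<and> ac = ae)" "\<not> (ab = ad \<and> ad = ae)" "\<not> (ac = ad \<and> ad = ae)"
    "\<not> (ab = bc \<and> bc = bd)" "\<not> (ab = bc \<and> bc = be)" "\<not> (ab = bd \<and> bd = be)" "\<not> (bc = bd \<and> bd = be)"
    "\<not> (ac = bc \<and> bc = cd)" "\<not> (ac = bc \<and> bc = ce)" "\<not> (ac = cd \<and> cd = ce)" "\<not> (bc = cd \<and> cd = ce)"
    "\<not> (ad = bd \<and> bd = cd)" "\<not> (ad = bd \<and> bd = de)" "\<not> (ad = cd \<and> cd = de)" "\<not> (bd = cd \<and> cd = de)"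
    "\<not> (ae = be \<and> be = ce)" "\<not> (ae = be \<and> be = de)" "\<not> (ae = ce \<and> ce = de)" "\<not> (be = ce \<and> ce = de)"
  shows "{ab, ac, ad, ae, bc, bd, be} \<subseteq> {ab, ac} \<or> {ab, ac, ad, ae, bc, bd, be} \<subseteq> {ab, ad}"
  using assms by auto

text \<open>The situation to be refuted for the upper bound, with colors as a symmetric function of
  two vertices instead of a function on edge sets. As \<open>a\<close> and \<open>b\<close> may
  coincide, monochromatic books are covered.\<close>

locale book_free =
  fixes V :: "nat set" and g :: "nat \<Rightarrow> nat \<Rightarrow> nat"
  assumes sym: "g x y = g y x"
    and gallai: "\<lbrakk>{x, y, z} \<subseteq> V; distinct [x, y, z]\<rbrakk> \<Longrightarrow> g x y = g x z \<or> g x y = g y z \<or> g x z = g y z"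
    and book_free: "\<lbrakk>{x, y, p, q, r} \<subseteq> V; distinct [x, y, p, q, r]\<rbrakk> \<Longrightarrow>
      \<not> {g x y, g x p, g x q, g x r, g y p, g y q, g y r} \<subseteq> {a, b}"
begin

lemma star_monochromatic:
  assumes "{v, w, p, q, r} \<subseteq> V" "distinct [v, w, p, q, r]" "g v p = g v q" "g v q = g v r"
  shows "g v w = g v p"
proof (rule ccontr)
  assume "g v w \<noteq> g v p"
  then have "g w s \<in> {g v w, g v p}" if "s \<in> {p, q, r}" for s
    using gallai[of v w s] assms that by auto
  then show False
    using book_free[of v w p q r "g v w" "g v p"] assms by auto
qed

lemma card_less_6:
  assumes "finite V"
  shows "card V < 6"
proof (rule ccontr)
  define mono where "mono v c \<longleftrightarrow> v \<in> V \<and> (\<forall>w\<in>V - {v}. g v w = c)" for v c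
  assume "\<not> card V < 6"
  then have card: "6 \<le> card V" by simp
  obtain x0 where "x0 \<in> V" using card by fastforce
  have mono_unique: "u = v" if "mono u c" "mono v d" for u v c d
  proof (rule ccontr)
    assume "u \<noteq> v"
    \<comment> \<open>Both colors are that of the edge \<open>uv\<close>.\<close>
    with that have [simp]: "d = c" unfolding mono_def using sym by (metis DiffI singletonD)
    have "3 \<le> card (V - {u, v})"
      using card \<open>u \<noteq> v\<close> that assms unfolding mono_def by (simp add: card_Diff_subset)
    then obtain P where "P \<subseteq> V - {u, v}" "card P = 3"
      by (meson obtain_subset_with_card_n)
    then obtain p q r where "P = {p, q, r}" "distinct [p, q, r]"
      unfolding card_3_iff by auto
    with \<open>P \<subseteq> _\<close> \<open>u \<noteq> v\<close> that show False
      using book_free[of u v p q r c c] unfolding mono_def by auto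
  qed
  \<comment> \<open>\<open>u\<close> is the monochromatic vertex if there is one, and otherwise the
    arbitrary vertex \<open>x0\<close>.\<close>
  obtain u where "u \<in> V" and nonmono: "\<And>w c. w \<in> V - {u} \<Longrightarrow> \<not> mono w c"
    using mono_unique \<open>x0 \<in> V\<close> unfolding mono_def by (metis DiffE singletonI)
  have deg: "\<not> (g v p = g v q \<and> g v q = g v r)"
    if "{v, p, q, r} \<subseteq> V - {u}" "distinct [v, p, q, r]" for v p q r
  proof
    assume eq: "g v p = g v q \<and> g v q = g v r"
    have "g v w = g v p" if "w \<in> V - {v}" for w
      using star_monochromatic[of v w p q r] that eq \<open>{v, p, q, r} \<subseteq> _\<close> \<open>distinct _\<close>
      by (cases "w \<in> {p, q, r}") auto
    then have "mono v (g v p)" using that unfolding mono_def by auto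
    with nonmono that show False by auto
  qed
  have "5 \<le> card (V - {u})" using card \<open>u \<in> V\<close> assms by simp
  then obtain W where W: "W \<subseteq> V - {u}" "card W = 5" by (meson obtain_subset_with_card_n)
  then have "finite W" by (simp add: card_ge_0_finite)
  then obtain ws where ws: "set ws = W" "distinct ws" using finite_distinct_list by blast
  then have "length ws = 5" using W distinct_card by fastforce
  then obtain a b c d e where abcde: "ws = [a, b, c, d, e]"
    by (auto simp: numeral_eq_Suc length_Suc_conv)
  \<comment> \<open>The reversed list gives the simplifier each disequality in the other
    orientation.\<close>
  have dist: "distinct [a, b, c, d, e]" "distinct [e, d, c, b, a]" and sub: "{a, b, c, d, e} \<subseteq> V - {u}"
    using ws abcde W by auto
  have tri: "g x y = g x z \<or> g x y = g y z \<or> g x z = g y z"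
    if "{x, y, z} \<subseteq> {a, b, c, d, e}" "distinct [x, y, z]" for x y z
    using gallai[of x y z] that sub by blast
  \<comment> \<open>\<open>K5_two_colored\<close> names each edge with its ends in alphabetical
    order. The four forms correspond to 0, 1, 2 or 3 neighbors preceding \<open>v\<close>.\<close>
  have dg: "\<not> (g v p = g v q \<and> g v q = g v r)" "\<not> (g p v = g v q \<and> g v q = g v r)"
    "\<not> (g p v = g q v \<and> g q v = g v r)" "\<not> (g p v = g q v \<and> g q v = g r v)"
    if "{v, p, q, r} \<subseteq> {a, b, c, d, e}" "distinct [v, p, q, r]" for v p q r
  proof -
    have "{v, p, q, r} \<subseteq> V - {u}" using that(1) sub by blast
    note deg[OF this that(2)]
    then show "\<not> (g v p = g v q \<and> g v q = g v r)" "\<not> (g p v = g v q \<and> g v q = g v r)"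
      "\<not> (g p v = g q v \<and> g q v = g v r)" "\<not> (g p v = g q v \<and> g q v = g r v)"
      by (simp_all only: sym[of p v] sym[of q v] sym[of r v] simp_thms)
  qed
  let ?S = "{g a b, g a c, g a d, g a e, g b c, g b d, g b e}"
  have "?S \<subseteq> {g a b, g a c} \<or> ?S \<subseteq> {g a b, g a d}"
    \<comment> \<open>These three edges join pages, so the conclusion does not determine them by
      unification.\<close>
    by (rule K5_two_colored[where cd = "g c d" and ce = "g c e" and de = "g d e"])
      ((rule tri dg; use dist in simp)+)
  then show False using book_free[of a b c d e] dist sub by auto
qed

end

lemma gallai_K6_book_3:
  assumes "gallai_coloring t 6 f"
  shows "\<exists>H. is_subgraph H (K 6) \<and> isomorphic (book 3) H \<and> card (f ` edges H) \<le> 2"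
proof (rule ccontr)
  assume no_copy: "\<not> ?thesis"
  interpret book_free "{..<6}" "\<lambda>x y. f {x, y}"
  proof
    show "f {x, y} = f {y, x}" for x y by (simp add: insert_commute)
    show "f {x, y} = f {x, z} \<or> f {x, y} = f {y, z} \<or> f {x, z} = f {y, z}"
      if "{x, y, z} \<subseteq> {..<6}" "distinct [x, y, z]" for x y z
      using assms that
      by (auto simp: gallai_coloring_def rainbow_triangle_def complete_graph_def)
    show "\<not> {f {x, y}, f {x, p}, f {x, q}, f {x, r}, f {y, p}, f {y, q}, f {y, r}} \<subseteq> {a, b}"
      if "{x, y, p, q, r} \<subseteq> {..<6}" "distinct [x, y, p, q, r]" for x y p q r a b
      using book_3_copy[OF that(2,1), of f a b] no_copy by auto
  qed
  show False using card_less_6 by simp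
qed

text \<open>The 4-cycle is 0, 2, 1, 3 in this order, with diagonals \<open>{0, 1}\<close> and
  \<open>{2, 3}\<close>; the fifth vertex is 4.\<close>

definition K5_coloring :: "nat set \<Rightarrow> nat" where
  "K5_coloring e = (if 4 \<in> e then 2 else if e = {0, 1} \<or> e = {2, 3} then 3 else 1)"

text \<open>A triangle through 4 has two edges of color 2, and any other triangle has only colors 1
  and 3. All \<open>p \<le> 5\<close> are treated because minimality has to exclude each of
  them.\<close>

lemma gallai_K5_coloring:
  assumes "3 \<le> t" "p \<le> 5"
  shows "gallai_coloring t p K5_coloring"
proof -
  have "\<not> rainbow_triangle p K5_coloring x y z" for x y z
  proof
    assume *: "rainbow_triangle p K5_coloring x y z"
    moreover have "{..<p} \<subseteq> {0, 1, 2, 3, 4}" using assms(2) by auto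
    ultimately have "x \<in> {0, 1, 2, 3, 4}" "y \<in> {0, 1, 2, 3, 4}" "z \<in> {0, 1, 2, 3, 4}"
      unfolding rainbow_triangle_def complete_graph_def by auto
    with * show False
      by (auto simp: rainbow_triangle_def K5_coloring_def doubleton_eq_iff)
  qed
  then show ?thesis
    using assms(1) by (auto simp: gallai_coloring_def coloring_def K5_coloring_def)
qed

lemma K5_coloring_book_3:
  assumes "p \<le> 5" "is_subgraph H (K p)" "isomorphic (book 3) H"
  shows "2 < card (K5_coloring ` edges H)"
proof -
  obtain \<phi> where \<phi>: "bij_betw \<phi> (verts (book 3)) (verts H)" "edges H = image \<phi> ` edges (book 3)"
    using assms(3) unfolding isomorphic_def by blast
  have vH: "verts H \<subseteq> {..<5}"
    using assms(1,2) by (auto simp: is_subgraph_def complete_graph_def)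
  have "card (verts H) = 5"
    using bij_betw_same_card[OF \<phi>(1)] by (simp add: verts_book_3)
  then have "verts H = {..<5}" using vH by (intro card_subset_eq) auto
  then have verts: "{..<5} = {\<phi> (Inl 0), \<phi> (Inl 1), \<phi> (Inr 0), \<phi> (Inr 1), \<phi> (Inr 2)}"
    using bij_betw_imp_surj_on[OF \<phi>(1)] by (simp add: verts_book_3)
  \<comment> \<open>The copy uses all five vertices, so an end of the spine is adjacent to every
    other vertex.\<close>
  have edges: "{z, w} \<in> edges H"
    if "z \<in> {\<phi> (Inl 0), \<phi> (Inl 1)}" "w < 5" "w \<noteq> z" for z w
  proof -
    have "w \<in> {\<phi> (Inl 0), \<phi> (Inl 1), \<phi> (Inr 0), \<phi> (Inr 1), \<phi> (Inr 2)}"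
      using that(2) verts by blast
    then show ?thesis
      using that(1,3) unfolding \<phi>(2) edges_book_3
      by (elim insertE emptyE) (simp_all add: doubleton_eq_iff)
  qed
  have "\<phi> (Inl 0) \<noteq> \<phi> (Inl 1)"
    using bij_betw_imp_inj_on[OF \<phi>(1)] by (auto simp: inj_on_def verts_book_3)
  \<comment> \<open>At most one end of the spine is the vertex 4; the other lies on the
    4-cycle.\<close>
  then obtain z where z: "z \<in> {\<phi> (Inl 0), \<phi> (Inl 1)}" "z \<noteq> 4" by (metis insertCI)
  then have "z < 5" using verts by blast
  then have "z \<in> {0, 1, 2, 3}" using z(2) by auto
  moreover have "{..<5::nat} = {0, 1, 2, 3, 4}" by auto
  ultimately have "{1, 2, 3} \<subseteq> K5_coloring ` (\<lambda>w. {z, w}) ` ({..<5} - {z})"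
    by (elim insertE emptyE) (simp_all add: K5_coloring_def doubleton_eq_iff insert_Diff_if)
  also have "\<dots> \<subseteq> K5_coloring ` edges H" using edges[OF z(1)] by auto
  finally have "card {1, 2, 3::nat} \<le> card (K5_coloring ` edges H)"
    by (rule card_mono[rotated]) (simp add: \<phi>(2) edges_book_3)
  then show ?thesis by simp
qed

theorem theorem3p1:
  fixes t :: nat
  assumes "t \<ge> 3"
  shows "gallai_ramsey t 2 (book 3) = 6"
  unfolding gallai_ramsey_def
proof (rule antisym)
  show "Inf {enat p |p. \<forall>f. gallai_coloring t p f \<longrightarrow>
      (\<exists>H. is_subgraph H (K p) \<and> isomorphic (book 3) H \<and> card (f ` edges H) \<le> 2)} \<le> 6"
    by (rule Inf_lower) (use gallai_K6_book_3 in \<open>auto simp: numeral_eq_enat\<close>)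
next
  have "6 \<le> p" if "\<forall>f. gallai_coloring t p f \<longrightarrow>
      (\<exists>H. is_subgraph H (K p) \<and> isomorphic (book 3) H \<and> card (f ` edges H) \<le> 2)" for p
  proof (rule ccontr)
    assume "\<not> 6 \<le> p"
    then have "p \<le> 5" by simp
    with that gallai_K5_coloring[OF assms] K5_coloring_book_3 show False
      by (meson not_less)
  qed
  then show "6 \<le> Inf {enat p |p. \<forall>f. gallai_coloring t p f \<longrightarrow>
      (\<exists>H. is_subgraph H (K p) \<and> isomorphic (book 3) H \<and> card (f ` edges H) \<le> 2)}"
    by (intro Inf_greatest) (auto simp: numeral_eq_enat)
qed

end
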